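(* Let $P=(X,\prec)$ be a finite twin-free interval order. The following are equivalent: (1) $P$ is a unit OC interval order; (2) $P$ is a strict OC interval order; (3) $P$ contains no induced subposet isomorphic to any of $\mathbf{4}+\mathbf{1}$, $\mathbf{3}+\mathbf{1}+\mathbf{1}$, $Z$, $D$, $Y$, or the dual of $Y$.
   Context: Posets are strict (irreflexive) partial orders. Two points are twins if they have exactly the same comparabilities; twin-free means no two distinct twins. $P$ is an interval order if each $x$ can be assigned a closed real interval $[L(x),R(x)]$ with $x\prec y$ iff $R(x)<L(y)$. An OC interval representation assigns to each $x\in X$ a real interval $I(x)$ that is either open or closed such that $x\prec y$ iff every point of $I(x)$ is less than every point of $I(y)$. A unit OC interval order has such a representation with all intervals of the same length. An interval $I(u)$ is strictly contained in $I(v)$ if $I(u)\subset I(v)$ and they do not have identical endpoints; an OC interval representation is strict if no interval is strictly contained in another, and $P$ is a strict OC interval order if it has a strict OC interval representation. Forbidden posets (pairs not listed or implied by transitivity are incomparable): $\mathbf{4}+\mathbf{1}$: $a\prec b\prec c\prec d$, plus isolated $x$. $\mathbf{3}+\mathbf{1}+\mathbf{1}$: $a\prec b\prec c$, plus isolated $x,y$. $Z$: elements $a,b,c,d,x,y$ with $a\prec b\prec c\prec d$, $x\prec d$, $a\prec y$. $D$: elements $a,b,c,d,x$ with $a\prec b\prec d$, $a\prec c\prec d$. $Y$: elements $a,b,c,d,x$ with $a\prec d\prec b$, $a\prec d\prec c$. The dual of a poset reverses all comparabilities. *)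

theory Defs
  imports Complex_Main
begin

definition strict_poset :: "'a set \<Rightarrow> ('a \<Rightarrow> 'a \<Rightarrow> bool) \<Rightarrow> bool" where
  "strict_poset X prec \<longleftrightarrow>
     (\<forall>x\<in>X. \<not> prec x x) \<and>
     (\<forall>x\<in>X. \<forall>y\<in>X. \<forall>z\<in>X. prec x y \<longrightarrow> prec y z \<longrightarrow> prec x z)"

definition twins :: "'a set \<Rightarrow> ('a \<Rightarrow> 'a \<Rightarrow> bool) \<Rightarrow> 'a \<Rightarrow> 'a \<Rightarrow> bool" where
  "twins X prec x y \<longleftrightarrow> (\<forall>z\<in>X. (prec z x \<longleftrightarrow> prec z y) \<and> (prec x z \<longleftrightarrow> prec y z))"

definition twin_free :: "'a set \<Rightarrow> ('a \<Rightarrow> 'a \<Rightarrow> bool) \<Rightarrow> bool" where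
  "twin_free X prec \<longleftrightarrow> (\<forall>x\<in>X. \<forall>y\<in>X. twins X prec x y \<longrightarrow> x = y)"

definition interval_order :: "'a set \<Rightarrow> ('a \<Rightarrow> 'a \<Rightarrow> bool) \<Rightarrow> bool" where
  "interval_order X prec \<longleftrightarrow>
     (\<exists>L R :: 'a \<Rightarrow> real. (\<forall>x\<in>X. L x \<le> R x) \<and>
        (\<forall>x\<in>X. \<forall>y\<in>X. prec x y \<longleftrightarrow> R x < L y))"

definition oc_set :: "real \<Rightarrow> real \<Rightarrow> bool \<Rightarrow> real set" where
  "oc_set l r c = (if c then {l..r} else {l<..<r})"

definition oc_valid :: "real \<Rightarrow> real \<Rightarrow> bool \<Rightarrow> bool" where
  "oc_valid l r c \<longleftrightarrow> (if c then l \<le> r else l < r)"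

definition OC_rep :: "'a set \<Rightarrow> ('a \<Rightarrow> 'a \<Rightarrow> bool) \<Rightarrow>
    ('a \<Rightarrow> real) \<Rightarrow> ('a \<Rightarrow> real) \<Rightarrow> ('a \<Rightarrow> bool) \<Rightarrow> bool" where
  "OC_rep X prec L R C \<longleftrightarrow>
     (\<forall>x\<in>X. oc_valid (L x) (R x) (C x)) \<and>
     (\<forall>x\<in>X. \<forall>y\<in>X. prec x y \<longleftrightarrow>
        (\<forall>p\<in>oc_set (L x) (R x) (C x). \<forall>q\<in>oc_set (L y) (R y) (C y). p < q))"

definition unit_OC_interval_order :: "'a set \<Rightarrow> ('a \<Rightarrow> 'a \<Rightarrow> bool) \<Rightarrow> bool" where
  "unit_OC_interval_order X prec \<longleftrightarrow>
     (\<exists>L R C len. OC_rep X prec L R C \<and> (\<forall>x\<in>X. R x - L x = len))"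

definition strictly_contained :: "real \<Rightarrow> real \<Rightarrow> bool \<Rightarrow> real \<Rightarrow> real \<Rightarrow> bool \<Rightarrow> bool" where
  "strictly_contained lu ru cu lv rv cv \<longleftrightarrow>
     oc_set lu ru cu \<subseteq> oc_set lv rv cv \<and> (lu, ru) \<noteq> (lv, rv)"

definition strict_OC_interval_order :: "'a set \<Rightarrow> ('a \<Rightarrow> 'a \<Rightarrow> bool) \<Rightarrow> bool" where
  "strict_OC_interval_order X prec \<longleftrightarrow>
     (\<exists>L R C. OC_rep X prec L R C \<and>
        (\<forall>u\<in>X. \<forall>v\<in>X. \<not> strictly_contained (L u) (R u) (C u) (L v) (R v) (C v)))"

definition contains_induced :: "'a set \<Rightarrow> ('a \<Rightarrow> 'a \<Rightarrow> bool) \<Rightarrow> nat \<Rightarrow> (nat \<Rightarrow> nat \<Rightarrow> bool) \<Rightarrow> bool" where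
  "contains_induced X prec n Q \<longleftrightarrow>
     (\<exists>f. inj_on f {..<n} \<and> f ` {..<n} \<subseteq> X \<and>
          (\<forall>i<n. \<forall>j<n. prec (f i) (f j) \<longleftrightarrow> Q i j))"

text \<open>Forbidden posets (relations already transitively closed).\<close>
(* 4+1: a=0<b=1<c=2<d=3, x=4 isolated *)
definition pat_4_1 :: "nat \<Rightarrow> nat \<Rightarrow> bool" where
  "pat_4_1 i j \<longleftrightarrow> i < j \<and> j \<le> 3"
(* 3+1+1: a=0<b=1<c=2, x=3, y=4 isolated *)
definition pat_3_1_1 :: "nat \<Rightarrow> nat \<Rightarrow> bool" where
  "pat_3_1_1 i j \<longleftrightarrow> i < j \<and> j \<le> 2"
(* Z: a=0<b=1<c=2<d=3, x=4<d, a<y=5 *)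
definition pat_Z :: "nat \<Rightarrow> nat \<Rightarrow> bool" where
  "pat_Z i j \<longleftrightarrow> (i < j \<and> j \<le> 3) \<or> (i, j) = (4, 3) \<or> (i, j) = (0, 5)"
(* D: a=0<b=1<d=3, a<c=2<d, x=4 isolated *)
definition pat_D :: "nat \<Rightarrow> nat \<Rightarrow> bool" where
  "pat_D i j \<longleftrightarrow> (i, j) \<in> {(0,1), (0,2), (1,3), (2,3), (0,3)}"
(* Y: a=0<d=3<b=1, a<d<c=2, x=4 isolated *)
definition pat_Y :: "nat \<Rightarrow> nat \<Rightarrow> bool" where
  "pat_Y i j \<longleftrightarrow> (i, j) \<in> {(0,3), (3,1), (3,2), (0,1), (0,2)}"
definition pat_Y_dual :: "nat \<Rightarrow> nat \<Rightarrow> bool" where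
  "pat_Y_dual i j \<longleftrightarrow> pat_Y j i"

end

theory Submission
  imports Defs
begin

text \<open>
  In a strict OC representation, a point \<open>x\<close> incomparable to a chain \<open>a \<prec> b \<prec> c\<close> is forced to be
  closed, \<open>b\<close> is the open interval with the same endpoints, and \<open>a\<close>, \<open>c\<close> are closed intervals
  touching \<open>x\<close> in one point each. Two points with the same interval are twins, so
  each of the six posets contradicts this rigidity.

  Conversely, call \<open>b\<close> inner to \<open>x\<close> if the sets of predecessors and of successors of \<open>x\<close> are
  proper subsets of those of \<open>b\<close>. If the six posets are excluded, every \<open>b\<close> is inner to at most one
  \<open>x\<close>, the predecessor sets of \<open>b\<close> and \<open>x\<close> differ in exactly one element, which is itself not
  inner, and likewise for successor sets. The non-inner points are linearly ordered by their
  predecessor and successor sets. Placing them greedily from left to right as closed unit intervals,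
  and each inner \<open>b\<close> as the open interval with the endpoints of its \<open>x\<close>, gives a unit OC
  representation.
\<close>

section \<open>OC interval representations\<close>

text \<open>If \<open>l' < r\<close>, validity provides a point of the first interval at or above
  the midpoint of \<open>l'\<close> and \<open>r\<close>, and a point of the second at or below it.
  If \<open>r = l'\<close>, only two closed intervals share that point.\<close>

lemma oc_set_precedes_iff:
  assumes "oc_valid l r c" "oc_valid l' r' c'"
  shows "(\<forall>p\<in>oc_set l r c. \<forall>q\<in>oc_set l' r' c'. p < q) \<longleftrightarrow> r < l' \<or> r = l' \<and> \<not> (c \<and> c')"
    (is "?lhs \<longleftrightarrow> ?rhs")
proof
  assume ?rhs
  then show ?lhs
    by (force simp: oc_set_def split: if_splits)
next
  assume lhs: ?lhs
  show ?rhs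
  proof (rule ccontr)
    assume neg: "\<not> ?rhs"
    show False
    proof (cases "r = l'")
      case True
      with neg assms have "l' \<in> oc_set l r c" "l' \<in> oc_set l' r' c'"
        by (auto simp: oc_set_def oc_valid_def)
      with lhs show False by blast
    next
      case False
      with neg have "l' < r" by auto
      have "\<exists>p. p \<in> oc_set l r c \<and> (r + l') / 2 \<le> p"
      proof (cases c)
        case True
        with assms \<open>l' < r\<close> show ?thesis
          by (intro exI[of _ r]) (auto simp: oc_set_def oc_valid_def)
      next
        case False
        with assms have "l < r" by (simp add: oc_valid_def)
        \<comment> \<open>The maximum with \<open>l\<close> keeps the witness inside the open
          interval when \<open>l' < l\<close>.\<close>
        with False \<open>l' < r\<close> show ?thesis
          by (intro exI[of _ "(r + max l l') / 2"]) (auto simp: oc_set_def max_def field_simps)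
      qed
      moreover have "\<exists>q. q \<in> oc_set l' r' c' \<and> q \<le> (r + l') / 2"
      proof (cases c')
        case True
        with assms \<open>l' < r\<close> show ?thesis
          by (intro exI[of _ l']) (auto simp: oc_set_def oc_valid_def)
      next
        case False
        with assms have "l' < r'" by (simp add: oc_valid_def)
        with False \<open>l' < r\<close> show ?thesis
          by (intro exI[of _ "(l' + min r r') / 2"]) (auto simp: oc_set_def min_def field_simps)
      qed
      ultimately show False
        using lhs by force
    qed
  qed
qed

lemma OC_rep_iff:
  "OC_rep X prec L R C \<longleftrightarrow>
     (\<forall>x\<in>X. oc_valid (L x) (R x) (C x)) \<and>
     (\<forall>x\<in>X. \<forall>y\<in>X. prec x y \<longleftrightarrow> R x < L y \<or> R x = L y \<and> \<not> (C x \<and> C y))"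
  unfolding OC_rep_def
  by (rule conj_cong[OF refl], intro ball_cong refl) (simp add: oc_set_precedes_iff)

lemma oc_set_subsetD:
  assumes "oc_set l r c \<subseteq> oc_set l' r' c'" "oc_valid l r c"
  shows "l' \<le> l" "r \<le> r'"
proof -
  have "l' \<le> l \<and> r \<le> r'"
  proof (cases c)
    case True
    then have "l \<in> oc_set l' r' c'" "r \<in> oc_set l' r' c'"
      using assms by (auto simp: oc_set_def oc_valid_def)
    then show ?thesis
      by (auto simp: oc_set_def split: if_splits)
  next
    case False
    then have "l < r" and "{l<..<r} \<subseteq> {l'..r'}"
      using assms by (auto simp: oc_set_def oc_valid_def split: if_splits)
    then show ?thesis
      by (simp add: greaterThanLessThan_subseteq_atLeastAtMost_iff)
  qed
  then show "l' \<le> l" "r \<le> r'" by auto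
qed

text \<open>Containment orders both pairs of endpoints, and equal lengths turn these inequalities
  into equalities.\<close>

lemma unit_imp_strict_OC_interval_order:
  assumes "unit_OC_interval_order X prec"
  shows "strict_OC_interval_order X prec"
proof -
  obtain L R C len where rep: "OC_rep X prec L R C" and len: "\<And>x. x \<in> X \<Longrightarrow> R x - L x = len"
    using assms by (auto simp: unit_OC_interval_order_def)
  have "\<not> strictly_contained (L u) (R u) (C u) (L v) (R v) (C v)" if "u \<in> X" "v \<in> X" for u v
  proof
    assume sc: "strictly_contained (L u) (R u) (C u) (L v) (R v) (C v)"
    have "oc_valid (L u) (R u) (C u)"
      using rep that by (simp add: OC_rep_def)
    then have "L v \<le> L u" "R u \<le> R v"
      using sc oc_set_subsetD by (auto simp: strictly_contained_def)
    with len[OF that(1)] len[OF that(2)] sc show False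
      by (auto simp: strictly_contained_def)
  qed
  with rep show ?thesis
    unfolding strict_OC_interval_order_def by blast
qed

section \<open>Rigidity of strict representations\<close>

locale strict_OC_rep =
  fixes X :: "'a set" and prec :: "'a \<Rightarrow> 'a \<Rightarrow> bool" (infix "\<prec>" 50)
    and L R :: "'a \<Rightarrow> real" and C :: "'a \<Rightarrow> bool"
  assumes rep: "OC_rep X (\<prec>) L R C"
    and strict: "\<And>u v. u \<in> X \<Longrightarrow> v \<in> X \<Longrightarrow>
      \<not> strictly_contained (L u) (R u) (C u) (L v) (R v) (C v)"
    and twin_free: "twin_free X (\<prec>)"
begin

lemma prec_iff: "x \<in> X \<Longrightarrow> y \<in> X \<Longrightarrow> x \<prec> y \<longleftrightarrow> R x < L y \<or> R x = L y \<and> \<not> (C x \<and> C y)"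
  using rep by (simp add: OC_rep_iff)

lemma same_interval_eq:
  assumes "x \<in> X" "y \<in> X" "L x = L y" "R x = R y" "C x = C y"
  shows "x = y"
proof -
  have "twins X (\<prec>) x y"
    using assms by (auto simp: twins_def prec_iff)
  then show ?thesis
    using twin_free assms by (simp add: twin_free_def)
qed

text \<open>Nested endpoints may fail to give nested sets only when \<open>u\<close> is closed,
  \<open>v\<close> is open and they share an endpoint; the last hypothesis excludes this.\<close>

lemma same_endpoints_if_nested:
  assumes "u \<in> X" "v \<in> X" "L v \<le> L u" "R u \<le> R v"
    "C v \<or> \<not> C u \<or> L v < L u \<and> R u < R v"
  shows "L u = L v" "R u = R v"
proof -
  have "oc_set (L u) (R u) (C u) \<subseteq> oc_set (L v) (R v) (C v)"
    using assms by (auto simp: oc_set_def)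
  then show "L u = L v" "R u = R v"
    using strict[OF assms(1,2)] by (auto simp: strictly_contained_def)
qed

text \<open>The hypotheses give \<open>L x \<le> R a \<le> L b\<close> and
  \<open>R b \<le> L c \<le> R x\<close>, so \<open>b\<close> is nested in \<open>x\<close> and
  strictness collapses both chains to equalities. Where endpoints touch, non-precedence forces
  closed intervals, and \<open>a \<prec> b\<close> then forces \<open>b\<close> to be open.\<close>

lemma three_plus_one:
  assumes X: "a \<in> X" "b \<in> X" "c \<in> X" "x \<in> X"
    and "a \<prec> b" "b \<prec> c" "\<not> a \<prec> x" "\<not> x \<prec> c"
  shows "L b = L x" "R b = R x" "R a = L x" "L c = R x" "C a" "C c" "C x" "\<not> C b"
proof -
  note facts = assms(5-8)[unfolded prec_iff[OF X(1,2)] prec_iff[OF X(2,3)]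
      prec_iff[OF X(1,4)] prec_iff[OF X(4,3)]]
  have "L x \<le> L b" "R b \<le> R x" "C x \<or> L x < L b \<and> R b < R x"
    using facts by auto
  then have "L b = L x" "R b = R x"
    using same_endpoints_if_nested[OF X(2,4)] by auto
  with facts show "L b = L x" "R b = R x" "R a = L x" "L c = R x" "C a" "C c" "C x" "\<not> C b"
    by auto
qed

text \<open>The second element of the chain is open as the middle of the first three and closed as
  the bottom of the last three.\<close>

lemma no_4_1: "\<not> contains_induced X (\<prec>) 5 pat_4_1"
proof
  assume "contains_induced X (\<prec>) 5 pat_4_1"
  then obtain f where f: "f ` {..<5} \<subseteq> X" "\<forall>i<5. \<forall>j<5. f i \<prec> f j \<longleftrightarrow> pat_4_1 i j"
    unfolding contains_induced_def by auto
  then have X: "f 0 \<in> X" "f 1 \<in> X" "f 2 \<in> X" "f 3 \<in> X" "f 4 \<in> X" by auto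
  have "f 0 \<prec> f 1" "f 1 \<prec> f 2" "f 2 \<prec> f 3" "\<not> f 0 \<prec> f 4" "\<not> f 1 \<prec> f 4" "\<not> f 4 \<prec> f 2"
    "\<not> f 4 \<prec> f 3"
    using f(2) by (auto simp: pat_4_1_def)
  then show False
    using three_plus_one[OF X(1,2,3,5)] three_plus_one[OF X(2,3,4,5)] by auto
qed

lemma no_3_1_1: "\<not> contains_induced X (\<prec>) 5 pat_3_1_1"
proof
  assume "contains_induced X (\<prec>) 5 pat_3_1_1"
  then obtain f where f: "inj_on f {..<5}" "f ` {..<5} \<subseteq> X"
      "\<forall>i<5. \<forall>j<5. f i \<prec> f j \<longleftrightarrow> pat_3_1_1 i j"
    unfolding contains_induced_def by auto
  then have X: "f 0 \<in> X" "f 1 \<in> X" "f 2 \<in> X" "f 3 \<in> X" "f 4 \<in> X" by auto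
  have "f 0 \<prec> f 1" "f 1 \<prec> f 2" "\<not> f 0 \<prec> f 3" "\<not> f 0 \<prec> f 4" "\<not> f 3 \<prec> f 2" "\<not> f 4 \<prec> f 2"
    using f(3) by (auto simp: pat_3_1_1_def)
  then have "f 3 = f 4"
    using three_plus_one[OF X(1,2,3,4)] three_plus_one[OF X(1,2,3,5)]
    by (intro same_interval_eq X) auto
  then show False
    using f(1) by (auto dest: inj_onD)
qed

text \<open>The same open/closed clash at \<open>b\<close> as for \<open>4+1\<close>, with
  \<open>x\<close> testing the triple \<open>a, b, c\<close> and \<open>y\<close> testing
  \<open>b, c, d\<close>.\<close>

lemma no_Z: "\<not> contains_induced X (\<prec>) 6 pat_Z"
proof
  assume "contains_induced X (\<prec>) 6 pat_Z"
  then obtain f where f: "f ` {..<6} \<subseteq> X" "\<forall>i<6. \<forall>j<6. f i \<prec> f j \<longleftrightarrow> pat_Z i j"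
    unfolding contains_induced_def by auto
  then have X: "f 0 \<in> X" "f 1 \<in> X" "f 2 \<in> X" "f 3 \<in> X" "f 4 \<in> X" "f 5 \<in> X" by auto
  have "f 0 \<prec> f 1" "f 1 \<prec> f 2" "f 2 \<prec> f 3" "\<not> f 0 \<prec> f 4" "\<not> f 4 \<prec> f 2"
    "\<not> f 1 \<prec> f 5" "\<not> f 5 \<prec> f 3"
    using f(2) by (auto simp: pat_Z_def)
  then show False
    using three_plus_one[OF X(1,2,3,5)] three_plus_one[OF X(2,3,4,6)]
    by auto
qed

lemma no_D: "\<not> contains_induced X (\<prec>) 5 pat_D"
proof
  assume "contains_induced X (\<prec>) 5 pat_D"
  then obtain f where f: "inj_on f {..<5}" "f ` {..<5} \<subseteq> X"
      "\<forall>i<5. \<forall>j<5. f i \<prec> f j \<longleftrightarrow> pat_D i j"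
    unfolding contains_induced_def by auto
  then have X: "f 0 \<in> X" "f 1 \<in> X" "f 2 \<in> X" "f 3 \<in> X" "f 4 \<in> X" by auto
  have "f 0 \<prec> f 1" "f 1 \<prec> f 3" "f 0 \<prec> f 2" "f 2 \<prec> f 3" "\<not> f 0 \<prec> f 4" "\<not> f 4 \<prec> f 3"
    using f(3) by (auto simp: pat_D_def)
  then have "f 1 = f 2"
    using three_plus_one[OF X(1,2,4,5)] three_plus_one[OF X(1,3,4,5)]
    by (intro same_interval_eq X) auto
  then show False
    using f(1) by (auto dest: inj_onD)
qed

lemma no_Y: "\<not> contains_induced X (\<prec>) 5 pat_Y"
proof
  assume "contains_induced X (\<prec>) 5 pat_Y"
  then obtain f where f: "inj_on f {..<5}" "f ` {..<5} \<subseteq> X"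
      "\<forall>i<5. \<forall>j<5. f i \<prec> f j \<longleftrightarrow> pat_Y i j"
    unfolding contains_induced_def by auto
  then have X: "f 0 \<in> X" "f 1 \<in> X" "f 2 \<in> X" "f 3 \<in> X" "f 4 \<in> X" by auto
  have "f 0 \<prec> f 3" "f 3 \<prec> f 1" "f 3 \<prec> f 2" "\<not> f 0 \<prec> f 4" "\<not> f 4 \<prec> f 1" "\<not> f 4 \<prec> f 2"
    using f(3) by (auto simp: pat_Y_def)
  then have "L (f 1) = L (f 2)" "C (f 1)" "C (f 2)"
    using three_plus_one[OF X(1,4,2,5)] three_plus_one[OF X(1,4,3,5)]
    by auto
  \<comment> \<open>Two closed intervals with a common left endpoint are nested, so strictness makes
    them equal.\<close>
  moreover from this have "R (f 1) = R (f 2)"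
    using same_endpoints_if_nested[OF X(2,3)] same_endpoints_if_nested[OF X(3,2)]
    by (cases "R (f 1) \<le> R (f 2)") auto
  ultimately have "f 1 = f 2"
    by (intro same_interval_eq X) auto
  then show False
    using f(1) by (auto dest: inj_onD)
qed

lemma no_Y_dual: "\<not> contains_induced X (\<prec>) 5 pat_Y_dual"
proof
  assume "contains_induced X (\<prec>) 5 pat_Y_dual"
  then obtain f where f: "inj_on f {..<5}" "f ` {..<5} \<subseteq> X"
      "\<forall>i<5. \<forall>j<5. f i \<prec> f j \<longleftrightarrow> pat_Y_dual i j"
    unfolding contains_induced_def by auto
  then have X: "f 0 \<in> X" "f 1 \<in> X" "f 2 \<in> X" "f 3 \<in> X" "f 4 \<in> X" by auto
  have "f 3 \<prec> f 0" "f 1 \<prec> f 3" "f 2 \<prec> f 3" "\<not> f 4 \<prec> f 0" "\<not> f 1 \<prec> f 4" "\<not> f 2 \<prec> f 4"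
    using f(3) by (auto simp: pat_Y_dual_def pat_Y_def)
  then have "R (f 1) = R (f 2)" "C (f 1)" "C (f 2)"
    using three_plus_one[OF X(2,4,1,5)] three_plus_one[OF X(3,4,1,5)]
    by auto
  moreover from this have "L (f 1) = L (f 2)"
    using same_endpoints_if_nested[OF X(2,3)] same_endpoints_if_nested[OF X(3,2)]
    by (cases "L (f 1) \<le> L (f 2)") auto
  ultimately have "f 1 = f 2"
    by (intro same_interval_eq X) auto
  then show False
    using f(1) by (auto dest: inj_onD)
qed

end

section \<open>Greedy placement of unit intervals\<close>

text \<open>Here \<open>ge\<close> stands for a distance of at least one and \<open>gt\<close> for
  more than one. Points are added by increasing \<open>\<rho>\<close>; the new coordinate has lower
  and upper bounds from the old points, and \<open>right\<close> and \<open>left\<close> make these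
  bounds compatible.\<close>

lemma greedy_placement:
  fixes \<rho> :: "'a \<Rightarrow> int" and ge gt :: "'a \<Rightarrow> 'a \<Rightarrow> bool"
  assumes "finite S" "inj_on \<rho> S"
    and gt_ge: "\<And>u v. u \<in> S \<Longrightarrow> v \<in> S \<Longrightarrow> gt u v \<Longrightarrow> ge u v"
    and right: "\<And>u v w. u \<in> S \<Longrightarrow> v \<in> S \<Longrightarrow> w \<in> S \<Longrightarrow> \<rho> u < \<rho> v \<Longrightarrow> \<rho> v < \<rho> w \<Longrightarrow> ge u v \<Longrightarrow> gt u w"
    and left: "\<And>u v w. u \<in> S \<Longrightarrow> v \<in> S \<Longrightarrow> w \<in> S \<Longrightarrow> \<rho> u < \<rho> v \<Longrightarrow> \<rho> v < \<rho> w \<Longrightarrow> ge v w \<Longrightarrow> gt u w"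
  shows "\<exists>l :: 'a \<Rightarrow> real. \<forall>u\<in>S. \<forall>v\<in>S. \<rho> u < \<rho> v \<longrightarrow>
    l u < l v \<and> (ge u v \<longleftrightarrow> l u + 1 \<le> l v) \<and> (gt u v \<longleftrightarrow> l u + 1 < l v)"
  using assms
proof (induction S rule: finite_ranking_induct[where f = \<rho>])
  case empty
  then show ?case by simp
next
  case (insert w S)
  have IH: "\<exists>l :: 'a \<Rightarrow> real. \<forall>u\<in>S. \<forall>v\<in>S. \<rho> u < \<rho> v \<longrightarrow>
      l u < l v \<and> (ge u v \<longleftrightarrow> l u + 1 \<le> l v) \<and> (gt u v \<longleftrightarrow> l u + 1 < l v)"
  proof (rule insert.IH)
    show "inj_on \<rho> S"
      using insert.prems(1) by simp
    show "ge u v" if "u \<in> S" "v \<in> S" "gt u v" for u v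
      using insert.prems(2) that by simp
    show "gt u z" if "u \<in> S" "v \<in> S" "z \<in> S" "\<rho> u < \<rho> v" "\<rho> v < \<rho> z" "ge u v" for u v z
      using that by (intro insert.prems(3)[of u v z]) auto
    show "gt u z" if "u \<in> S" "v \<in> S" "z \<in> S" "\<rho> u < \<rho> v" "\<rho> v < \<rho> z" "ge v z" for u v z
      using that by (intro insert.prems(4)[of u v z]) auto
  qed
  show ?case
  \<comment> \<open>The ranking induction does not guarantee that \<open>w\<close> is new.\<close>
  proof (cases "w \<in> S")
    case True
    with IH show ?thesis by (simp only: insert_absorb)
  next
    case False
    have less_w: "\<rho> u < \<rho> w" if "u \<in> S" for u
    proof -
      have "\<rho> u \<noteq> \<rho> w"
        using inj_onD[OF insert.prems(1), of u w] that False by auto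
      with insert.hyps(2)[OF that] show ?thesis by simp
    qed
    from IH obtain l :: "'a \<Rightarrow> real" where l: "\<And>u v. u \<in> S \<Longrightarrow> v \<in> S \<Longrightarrow> \<rho> u < \<rho> v \<Longrightarrow>
        l u < l v \<and> (ge u v \<longleftrightarrow> l u + 1 \<le> l v) \<and> (gt u v \<longleftrightarrow> l u + 1 < l v)"
      by blast
    have inj: "\<rho> u = \<rho> v \<Longrightarrow> u = v" if "u \<in> S" "v \<in> S" for u v
      using insert.prems(1) that by (auto dest: inj_onD)
    have gt_ge: "gt u w \<Longrightarrow> ge u w" if "u \<in> S" for u
      using insert.prems(2) that by blast
    \<comment> \<open>A \<open>v\<close> at distance one or more to the right of \<open>u\<close>
      would force \<open>gt u w\<close>.\<close>
    have right: "l v < l u + 1" if "u \<in> S" "v \<in> S" "\<not> gt u w" for u v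
    proof (cases "\<rho> u < \<rho> v")
      case True
      then have "\<not> ge u v"
        using insert.prems(3)[of u v w] less_w that by auto
      then show ?thesis
        using l[OF that(1,2) True] by auto
    next
      case False
      then show ?thesis
        using l[OF that(2,1)] inj[OF that(1,2)] by (cases "\<rho> v < \<rho> u") fastforce+
    qed
    have left: "l u < l v" if "u \<in> S" "v \<in> S" "gt u w \<and> \<not> gt v w \<or> ge u w \<and> \<not> ge v w" for u v
    proof -
      have "\<not> \<rho> v < \<rho> u"
        using insert.prems(4)[of v u w] gt_ge that less_w by auto
      with that have "\<rho> u < \<rho> v"
        using inj[OF that(1,2)] by (cases "\<rho> u" "\<rho> v" rule: linorder_cases) auto
      then show ?thesis
        using l[OF that(1,2)] by auto
    qed
    have "\<exists>t. \<forall>u\<in>S. l u < t \<and> (ge u w \<longleftrightarrow> l u + 1 \<le> t) \<and> (gt u w \<longleftrightarrow> l u + 1 < t)"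
    \<comment> \<open>Such a \<open>z\<close> must lie at distance exactly one from
      \<open>w\<close>, which fixes \<open>t = l z + 1\<close>. It is unique: of two candidates, the
      earlier one would satisfy \<open>gt\<close>.\<close>
    proof (cases "\<exists>z\<in>S. ge z w \<and> \<not> gt z w")
      case True
      then obtain z where z: "z \<in> S" "ge z w" "\<not> gt z w" by blast
      have "l u < l z + 1 \<and> (ge u w \<longleftrightarrow> l u + 1 \<le> l z + 1) \<and> (gt u w \<longleftrightarrow> l u + 1 < l z + 1)"
        if u: "u \<in> S" for u
      proof -
        have "u = z" if "ge u w" "\<not> gt u w"
        proof (rule ccontr)
          assume "u \<noteq> z"
          then have "\<rho> u \<noteq> \<rho> z"
            using inj[OF u z(1)] by blast
          then have "\<rho> u < \<rho> z \<or> \<rho> z < \<rho> u" by linarith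
          then show False
            using insert.prems(4)[of u z w] insert.prems(4)[of z u w] z u that less_w by auto
        qed
        then show ?thesis
          using right[OF z(1) u z(3)] left[OF u z(1)] left[OF z(1) u] gt_ge[OF u] z
          by (cases "gt u w"; cases "ge u w") auto
      qed
      then show ?thesis by blast
    next
      case False
      \<comment> \<open>Now \<open>ge\<close> and \<open>gt\<close> agree towards \<open>w\<close>,
        so every constraint is strict: \<open>A\<close> collects the lower bounds on
        \<open>t\<close> and \<open>B\<close> the upper bounds.\<close>
      define A where "A = l ` S \<union> (\<lambda>u. l u + 1) ` {u \<in> S. ge u w}"
      define B where "B = (\<lambda>u. l u + 1) ` {u \<in> S. \<not> ge u w}"
      have fin: "finite A" "finite B"
        using insert.hyps(1) by (auto simp: A_def B_def)
      have AB: "a < b" if "a \<in> A" "b \<in> B" for a b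
        using that right left gt_ge by (fastforce simp: A_def B_def)
      have "\<exists>t. (\<forall>a\<in>A. a < t) \<and> (\<forall>b\<in>B. t < b)"
      proof (cases "B = {}")
        case True
        have "a < Max A + 1" if "a \<in> A" for a
          using Max_ge[OF fin(1) that] by simp
        with True show ?thesis by blast
      next
        case False
        then have "A \<noteq> {}" by (auto simp: A_def B_def)
        with False have "Max A < Min B" using AB fin by simp
        then obtain t where "Max A < t" "t < Min B" using dense by blast
        with \<open>A \<noteq> {}\<close> False fin show ?thesis by auto
      qed
      then obtain t where t: "\<forall>a\<in>A. a < t" "\<forall>b\<in>B. t < b" by blast
      show ?thesis
      proof (intro exI[of _ t] ballI)
        fix u assume u: "u \<in> S"
        then have "l u < t"
          using t(1) by (simp add: A_def)
        moreover have "l u + 1 < t" "gt u w" if "ge u w"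
          using t(1) False u that by (auto simp: A_def)
        moreover have "t < l u + 1" if "\<not> ge u w"
          using t(2) u that by (auto simp: B_def)
        ultimately
        show "l u < t \<and> (ge u w \<longleftrightarrow> l u + 1 \<le> t) \<and> (gt u w \<longleftrightarrow> l u + 1 < t)"
          using gt_ge[OF u] by (cases "ge u w") auto
      qed
    qed
    then obtain t where t: "\<And>u. u \<in> S \<Longrightarrow>
        l u < t \<and> (ge u w \<longleftrightarrow> l u + 1 \<le> t) \<and> (gt u w \<longleftrightarrow> l u + 1 < t)"
      by blast
    show ?thesis
    proof (intro exI[of _ "l(w := t)"] ballI impI)
      fix u v
      assume "u \<in> insert w S" "v \<in> insert w S" "\<rho> u < \<rho> v"
      then show "(l(w := t)) u < (l(w := t)) v \<and>
          (ge u v \<longleftrightarrow> (l(w := t)) u + 1 \<le> (l(w := t)) v) \<and>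
          (gt u v \<longleftrightarrow> (l(w := t)) u + 1 < (l(w := t)) v)"
        using l t less_w False by (auto dest: less_w)
    qed
  qed
qed

section \<open>Interval orders without the forbidden posets\<close>

text \<open>The witnesses \<open>a\<close> and \<open>c\<close> make the inclusions proper; the
  inclusions themselves follow from the Ferrers property, in \<open>inner_pred\<close> and
  \<open>inner_succ\<close>.\<close>

definition inner :: "'a set \<Rightarrow> ('a \<Rightarrow> 'a \<Rightarrow> bool) \<Rightarrow> 'a \<Rightarrow> 'a \<Rightarrow> bool" where
  "inner X prec b x \<longleftrightarrow> b \<in> X \<and> x \<in> X \<and>
     (\<exists>a\<in>X. prec a b \<and> \<not> prec a x) \<and> (\<exists>c\<in>X. prec b c \<and> \<not> prec x c)"

definition non_inner :: "'a set \<Rightarrow> ('a \<Rightarrow> 'a \<Rightarrow> bool) \<Rightarrow> 'a set" where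
  "non_inner X prec = {x \<in> X. \<nexists>y. inner X prec x y}"

definition before :: "'a set \<Rightarrow> ('a \<Rightarrow> 'a \<Rightarrow> bool) \<Rightarrow> 'a \<Rightarrow> 'a \<Rightarrow> bool" where
  "before X prec u v \<longleftrightarrow> (\<forall>z\<in>X. (prec z u \<longrightarrow> prec z v) \<and> (prec v z \<longrightarrow> prec u z))"

text \<open>The points that get the same endpoints as \<open>u\<close> in the representation.\<close>

definition cell :: "'a set \<Rightarrow> ('a \<Rightarrow> 'a \<Rightarrow> bool) \<Rightarrow> 'a \<Rightarrow> 'a set" where
  "cell X prec u = {s. s = u \<or> inner X prec s u}"

text \<open>This becomes \<open>ge\<close> in \<open>greedy_placement\<close>: one comparability
  between two cells already forces their common endpoints at least one unit apart.\<close>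

definition cell_prec :: "'a set \<Rightarrow> ('a \<Rightarrow> 'a \<Rightarrow> bool) \<Rightarrow> 'a \<Rightarrow> 'a \<Rightarrow> bool" where
  "cell_prec X prec u v \<longleftrightarrow> (\<exists>s\<in>cell X prec u. \<exists>t\<in>cell X prec v. prec s t)"

text \<open>This and the next four lemmas serve to obtain left-right mirror images of results by
  duality.\<close>

lemma inner_converse: "inner X (\<lambda>x y. prec y x) = inner X prec"
  by (auto simp: inner_def fun_eq_iff)

lemma non_inner_converse: "non_inner X (\<lambda>x y. prec y x) = non_inner X prec"
  by (simp add: non_inner_def inner_converse[of X prec])

lemma cell_converse: "cell X (\<lambda>x y. prec y x) = cell X prec"
  by (simp add: cell_def inner_converse[of X prec] fun_eq_iff)

lemma before_converse: "before X (\<lambda>x y. prec y x) u v \<longleftrightarrow> before X prec v u"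
  by (auto simp: before_def)

lemma cell_prec_converse: "cell_prec X (\<lambda>x y. prec y x) u v \<longleftrightarrow> cell_prec X prec v u"
  by (auto simp: cell_prec_def cell_converse[of X prec])

text \<open>
  The assumptions that exclude the six posets list only the (in)comparabilities that do not already
  follow from \<open>irrefl\<close>, \<open>ferrers\<close> and, for \<open>D\<close>, \<open>Y\<close> and the dual of \<open>Y\<close>, from \<open>no_4_1\<close>.
\<close>

locale forbidden_free =
  fixes X :: "'a set" and prec :: "'a \<Rightarrow> 'a \<Rightarrow> bool" (infix "\<prec>" 50)
  assumes irrefl: "x \<in> X \<Longrightarrow> \<not> x \<prec> x"
    and ferrers: "\<lbrakk>x \<in> X; y \<in> X; z \<in> X; w \<in> X; x \<prec> y; z \<prec> w\<rbrakk> \<Longrightarrow> x \<prec> w \<or> z \<prec> y"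
    and twin_free: "\<lbrakk>x \<in> X; y \<in> X; twins X (\<prec>) x y\<rbrakk> \<Longrightarrow> x = y"
    and no_4_1: "\<lbrakk>a \<in> X; b \<in> X; c \<in> X; d \<in> X; x \<in> X; a \<prec> b; b \<prec> c; c \<prec> d\<rbrakk>
      \<Longrightarrow> a \<prec> x \<or> x \<prec> d"
    and no_3_1_1: "\<lbrakk>a \<in> X; b \<in> X; c \<in> X; x \<in> X; y \<in> X; a \<prec> b; b \<prec> c\<rbrakk>
      \<Longrightarrow> a \<prec> x \<or> x \<prec> c \<or> a \<prec> y \<or> y \<prec> c \<or> x = y"
    and no_Z: "\<lbrakk>a \<in> X; b \<in> X; c \<in> X; d \<in> X; x \<in> X; y \<in> X;
        a \<prec> b; b \<prec> c; c \<prec> d; x \<prec> d; a \<prec> y\<rbrakk>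
      \<Longrightarrow> a \<prec> x \<or> x \<prec> c \<or> b \<prec> y \<or> y \<prec> d"
    and no_D: "\<lbrakk>a \<in> X; b \<in> X; c \<in> X; d \<in> X; x \<in> X; a \<prec> b; b \<prec> d; a \<prec> c; c \<prec> d\<rbrakk>
      \<Longrightarrow> a \<prec> x \<or> x \<prec> d \<or> b = c"
    and no_Y: "\<lbrakk>a \<in> X; b \<in> X; c \<in> X; d \<in> X; x \<in> X; a \<prec> d; d \<prec> b; d \<prec> c\<rbrakk>
      \<Longrightarrow> a \<prec> x \<or> x \<prec> b \<or> x \<prec> c \<or> b = c"
    and no_Y_dual: "\<lbrakk>a \<in> X; b \<in> X; c \<in> X; d \<in> X; x \<in> X; d \<prec> a; b \<prec> d; c \<prec> d\<rbrakk>
      \<Longrightarrow> x \<prec> a \<or> b \<prec> x \<or> c \<prec> x \<or> b = c"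
begin

text \<open>Four of the forbidden posets are self-dual, and \<open>Y\<close> trades places with its
  dual.\<close>

lemma converse: "forbidden_free X (\<lambda>x y. y \<prec> x)"
proof (unfold_locales, goal_cases)
  case (1 x)
  then show ?case using irrefl by blast
next
  case (2 x y z w)
  then show ?case using ferrers[of w z y x] by blast
next
  case (3 x y)
  then show ?case by (intro twin_free) (auto simp: twins_def)
next
  case (4 a b c d x)
  then show ?case using no_4_1[of d c b a x] by blast
next
  case (5 a b c x y)
  then show ?case using no_3_1_1[of c b a x y] by blast
next
  case (6 a b c d x y)
  then show ?case using no_Z[of d c b a y x] by blast
next
  case (7 a b c d x)
  then show ?case using no_D[of d b c a x] by blast
next
  case (8 a b c d x)
  then show ?case using no_Y_dual[of a b c d x] by blast
next
  case (9 a b c d x)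
  then show ?case using no_Y[of a b c d x] by blast
qed

section \<open>Structure of the inner relation\<close>

abbreviation inn where "inn \<equiv> inner X (\<prec>)"
abbreviation Q where "Q \<equiv> non_inner X (\<prec>)"

lemma Q_subset: "x \<in> Q \<Longrightarrow> x \<in> X"
  by (simp add: non_inner_def)

lemma inner_in: "inn b x \<Longrightarrow> b \<in> X" "inn b x \<Longrightarrow> x \<in> X"
  by (auto simp: inner_def)

lemma inner_pred: "inn b x \<Longrightarrow> e \<in> X \<Longrightarrow> e \<prec> x \<Longrightarrow> e \<prec> b"
  unfolding inner_def using ferrers by blast

lemma inner_succ: "inn b x \<Longrightarrow> e \<in> X \<Longrightarrow> x \<prec> e \<Longrightarrow> b \<prec> e"
  unfolding inner_def using ferrers by blast

text \<open>By Ferrers, predecessor sets are nested, and so are successor sets. Hence one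
  \<open>a\<close> and one \<open>c\<close> witness both relations, and \<open>3+1+1\<close> is
  excluded.\<close>

lemma inner_unique:
  assumes "inn b x" "inn b y"
  shows "x = y"
proof -
  note X = inner_in[OF assms(1)] inner_in[OF assms(2)]
  have "\<exists>a\<in>X. a \<prec> b \<and> \<not> a \<prec> x \<and> \<not> a \<prec> y"
    using assms ferrers X unfolding inner_def by blast
  moreover have "\<exists>c\<in>X. b \<prec> c \<and> \<not> x \<prec> c \<and> \<not> y \<prec> c"
    using assms ferrers X unfolding inner_def by blast
  ultimately show ?thesis
    using no_3_1_1 X by blast
qed

text \<open>Common witnesses \<open>a\<close> and \<open>c\<close> exist again by Ferrers; distinct
  \<open>b\<close>, \<open>b'\<close> would then contradict \<open>no_D\<close>.\<close>

lemma inner_unique_left: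
  assumes "inn b x" "inn b' x"
  shows "b = b'"
proof -
  note X = inner_in[OF assms(1)] inner_in[OF assms(2)]
  have "\<exists>a\<in>X. a \<prec> b \<and> a \<prec> b' \<and> \<not> a \<prec> x"
    using assms ferrers X unfolding inner_def by blast
  moreover have "\<exists>c\<in>X. b \<prec> c \<and> b' \<prec> c \<and> \<not> x \<prec> c"
    using assms ferrers X unfolding inner_def by blast
  ultimately show ?thesis
    using no_D X by blast
qed

text \<open>Being inner is transitive, so uniqueness would make \<open>x\<close> inner to
  itself.\<close>

lemma inner_imp_non_inner:
  assumes "inn b x"
  shows "x \<in> Q"
proof -
  have False if "inn x y" for y
  proof -
    have "inn b y"
      using assms that inner_pred[OF assms] inner_succ[OF assms] unfolding inner_def by blast
    then have "x = y"
      using assms inner_unique by blast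
    with that show False
      by (simp add: inner_def)
  qed
  with inner_in[OF assms] show ?thesis
    by (auto simp: non_inner_def)
qed

lemma inner_succ_unique:
  assumes "inn b x" "c \<in> X" "b \<prec> c" "\<not> x \<prec> c" "c' \<in> X" "b \<prec> c'" "\<not> x \<prec> c'"
  shows "c = c'"
proof -
  obtain a where "a \<in> X" "a \<prec> b" "\<not> a \<prec> x"
    using assms(1) by (auto simp: inner_def)
  with assms inner_in[OF assms(1)] show ?thesis
    using no_Y by blast
qed

lemma inner_pred_unique:
  assumes "inn b x" "a \<in> X" "a \<prec> b" "\<not> a \<prec> x" "a' \<in> X" "a' \<prec> b" "\<not> a' \<prec> x"
  shows "a = a'"
proof -
  obtain c where "c \<in> X" "b \<prec> c" "\<not> x \<prec> c"
    using assms(1) by (auto simp: inner_def)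
  with assms inner_in[OF assms(1)] show ?thesis
    using no_Y_dual by blast
qed

text \<open>Otherwise the outer witnesses \<open>a\<close> below \<open>b\<close> and
  \<open>d\<close> above \<open>c\<close>, together with \<open>x\<close> and \<open>y\<close>, form
  a \<open>Z\<close> on the chain \<open>a, b, c, d\<close>. Its remaining relations come from the
  uniqueness of the differing successor and predecessor.\<close>

lemma inner_prec_inner:
  assumes "inn b x" "inn c y" "b \<prec> c"
  shows "x \<prec> c"
proof (rule ccontr)
  assume xc: "\<not> x \<prec> c"
  note X = inner_in[OF assms(1)] inner_in[OF assms(2)]
  obtain a where a: "a \<in> X" "a \<prec> b" "\<not> a \<prec> x"
    using assms(1) by (auto simp: inner_def)
  obtain d where d: "d \<in> X" "c \<prec> d" "\<not> y \<prec> d"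
    using assms(2) by (auto simp: inner_def)
  have "c \<noteq> d" "a \<noteq> b"
    using a d irrefl by blast+
  \<comment> \<open>Transitivity, derived from \<open>ferrers\<close> and
    \<open>irrefl\<close>.\<close>
  have "b \<prec> d"
    using ferrers[of b c c d] assms X d irrefl by blast
  then have xd: "x \<prec> d"
    using inner_succ_unique[OF assms(1), of c d] X d assms(3) xc \<open>c \<noteq> d\<close> by blast
  have nby: "\<not> b \<prec> y"
  proof
    assume "b \<prec> y"
    moreover have "\<not> x \<prec> y"
      using inner_pred[OF assms(2) X(2)] xc by blast
    ultimately have "y = c"
      using inner_succ_unique[OF assms(1), of c y] X xc assms(3) by blast
    with assms(2) show False by (simp add: inner_def)
  qed
  have "a \<prec> c"
    using ferrers[of a b b c] assms X a irrefl by blast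
  then have "a \<prec> y"
    using inner_pred_unique[OF assms(2), of a b] X a assms(3) nby \<open>a \<noteq> b\<close> by blast
  then show False
    using no_Z[of a b c d x y] a d X assms(3) xd xc nby by blast
qed

lemma inner_prec_inner':
  assumes "inn b x" "inn c y" "b \<prec> c"
  shows "b \<prec> y"
  using forbidden_free.inner_prec_inner[OF converse, of c y b x] assms
  by (simp add: inner_converse[of X "(\<prec>)"])

text \<open>Any comparability from the cell of \<open>u\<close> to that of \<open>v\<close> would
  put some point below itself. With \<open>u = v\<close> this says that each cell is an
  antichain.\<close>

lemma before_not_cell_prec:
  assumes "v \<in> Q" "u \<in> Q" "before X (\<prec>) v u"
  shows "\<not> cell_prec X (\<prec>) u v"
proof
  note X = assms(1,2)[THEN Q_subset]
  have uv: "\<not> u \<prec> v"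
    using assms(3) X irrefl by (auto simp: before_def)
  have 1: "\<not> b \<prec> v" if "inn b u" for b
    using assms(3) inner_in[OF that] inner_pred[OF that] irrefl by (auto simp: before_def)
  have 2: "\<not> u \<prec> c" if "inn c v" for c
    using assms(3) inner_in[OF that] inner_succ[OF that] irrefl by (auto simp: before_def)
  assume "cell_prec X (\<prec>) u v"
  then obtain s t where "s \<in> cell X (\<prec>) u" "t \<in> cell X (\<prec>) v" "s \<prec> t"
    by (auto simp: cell_prec_def)
  then show False
    using uv 1 2 inner_prec_inner[of s u t v] by (auto simp: cell_def)
qed

text \<open>This is the hypothesis \<open>right\<close> of \<open>greedy_placement\<close>. If it
  failed, either an inner \<open>b\<close> would have both \<open>v\<close> and \<open>w\<close> as
  successors missed by \<open>u\<close>, or an inner \<open>c\<close> would be inner to both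
  \<open>v\<close> and \<open>w\<close>.\<close>

lemma cell_prec_imp_prec_later:
  assumes Q: "u \<in> Q" "v \<in> Q" "w \<in> Q" and "before X (\<prec>) v w" "v \<noteq> w" "cell_prec X (\<prec>) u v"
  shows "u \<prec> w"
proof -
  note X = Q[THEN Q_subset]
  have 1: "u \<prec> w" if "inn b u" "b \<prec> v" for b
  proof (rule ccontr)
    assume uw: "\<not> u \<prec> w"
    then have "\<not> u \<prec> v" "b \<prec> w"
      using assms(4) X that inner_in[OF that(1)] by (auto simp: before_def)
    with uw that X assms(5) show False
      using inner_succ_unique by blast
  qed
  have 2: "u \<prec> w" if "inn c v" "u \<prec> c" for c
  proof (rule ccontr)
    assume uw: "\<not> u \<prec> w"
    then have uv: "\<not> u \<prec> v"
      using assms(4) X by (auto simp: before_def)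
    have cX: "c \<in> X" using inner_in that by blast
    \<comment> \<open>Otherwise \<open>e\<close> and \<open>u\<close> are both predecessors of
      \<open>c\<close> missed by \<open>v\<close>, hence equal. So \<open>v\<close> and
      \<open>w\<close> have the same predecessors, and twin-freeness moves their difference to the
      successors.\<close>
    have "e \<prec> v" if e: "e \<in> X" "e \<prec> w" for e
    proof (rule ccontr)
      assume "\<not> e \<prec> v"
      moreover have "e \<prec> c"
        using ferrers[of e w u c] e X cX \<open>u \<prec> c\<close> uw by blast
      ultimately have "e = u"
        using inner_pred_unique[OF \<open>inn c v\<close>] e X uv \<open>u \<prec> c\<close> by blast
      with e uw show False by blast
    qed
    then have "\<not> (\<forall>z\<in>X. v \<prec> z \<longrightarrow> w \<prec> z)"
      using twin_free[of v w] assms(4,5) X unfolding twins_def before_def by blast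
    then obtain z where "z \<in> X" "v \<prec> z" "\<not> w \<prec> z" by blast
    then have "inn c w"
      using X cX that uw inner_succ[OF that(1)] by (auto simp: inner_def)
    with that assms(5) show False
      using inner_unique by blast
  qed
  obtain s t where "s \<in> cell X (\<prec>) u" "t \<in> cell X (\<prec>) v" "s \<prec> t"
    using assms(6) by (auto simp: cell_prec_def)
  then show ?thesis
    using 1 2 inner_prec_inner assms(4) X by (auto simp: cell_def before_def)
qed

lemma cell_prec_imp_prec_earlier:
  assumes "u \<in> Q" "v \<in> Q" "w \<in> Q" "before X (\<prec>) u v" "u \<noteq> v" "cell_prec X (\<prec>) v w"
  shows "u \<prec> w"
  using forbidden_free.cell_prec_imp_prec_later[OF converse, of w v u] assms
  by (simp add: non_inner_converse[of X "(\<prec>)"] before_converse[of X "(\<prec>)"]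
      cell_prec_converse[of X "(\<prec>)"])

text \<open>By \<open>inner_prec_inner\<close>, a comparability between cells can be chosen with at
  most one inner end. A cell has only one inner point, so this comparability carries over to
  \<open>s\<close> and \<open>t\<close>.\<close>

lemma cell_prec_iff:
  assumes "s \<in> cell X (\<prec>) u" "t \<in> cell X (\<prec>) v" "s \<notin> Q \<or> t \<notin> Q" "u \<in> Q" "v \<in> Q"
  shows "s \<prec> t \<longleftrightarrow> cell_prec X (\<prec>) u v"
proof
  assume "s \<prec> t"
  with assms show "cell_prec X (\<prec>) u v" by (auto simp: cell_prec_def)
next
  note X = assms(4,5)[THEN Q_subset]
  assume "cell_prec X (\<prec>) u v"
  then obtain s' t' where "s' \<in> cell X (\<prec>) u" "t' \<in> cell X (\<prec>) v" "s' \<prec> t'"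
    by (auto simp: cell_prec_def)
  then have cases: "u \<prec> v \<or> (\<exists>b. inn b u \<and> b \<prec> v) \<or> (\<exists>c. inn c v \<and> u \<prec> c)"
    using inner_prec_inner by (auto simp: cell_def)
  consider "inn s u" "t = v" | "s = u" "inn t v" | "inn s u" "inn t v"
    using assms by (auto simp: cell_def)
  then show "s \<prec> t"
  proof cases
    case 1
    then show ?thesis
      using cases X inner_in inner_succ[OF 1(1)] inner_unique_left inner_prec_inner' by metis
  next
    case 2
    then show ?thesis
      using cases X inner_in inner_pred[OF 2(2)] inner_unique_left inner_prec_inner by metis
  next
    case 3
    then show ?thesis
      using cases X inner_in inner_pred[OF 3(2)] inner_succ[OF 3(1)] inner_unique_left by metis
  qed
qed

section \<open>Linear order of the non-inner points and the unit representation\<close>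

definition rank :: "'a \<Rightarrow> int" where
  "rank x = int (card {z \<in> X. z \<prec> x}) - int (card {z \<in> X. x \<prec> z})"

text \<open>Predecessor sets are nested, and so are successor sets; if the two orders disagreed, one
  point would be inner to the other.\<close>

lemma before_total:
  assumes "u \<in> Q" "v \<in> Q"
  shows "before X (\<prec>) u v \<or> before X (\<prec>) v u"
proof (rule ccontr)
  note X = assms[THEN Q_subset]
  have "\<not> inn u v" "\<not> inn v u"
    using assms by (auto simp: non_inner_def)
  moreover assume "\<not> ?thesis"
  ultimately show False
    using X ferrers unfolding inner_def before_def by blast
qed

lemma before_rank_le:
  assumes "finite X" "before X (\<prec>) u v"
  shows "rank u \<le> rank v"
proof -
  have "card {z \<in> X. z \<prec> u} \<le> card {z \<in> X. z \<prec> v}" "card {z \<in> X. v \<prec> z} \<le> card {z \<in> X. u \<prec> z}"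
    using assms by (auto simp: before_def intro!: card_mono)
  then show ?thesis by (simp add: rank_def)
qed

lemma rank_less_imp_before:
  assumes "finite X" "u \<in> Q" "v \<in> Q" "rank u < rank v"
  shows "before X (\<prec>) u v"
  using before_total[OF assms(2,3)] before_rank_le[OF assms(1), of v u] assms(4) by auto

text \<open>Equal ranks turn both cardinality inequalities into equalities, so the nested sets
  coincide and the points are twins.\<close>

lemma before_rank_eq_imp_eq:
  assumes "finite X" "u \<in> X" "v \<in> X" "before X (\<prec>) u v" "rank u = rank v"
  shows "u = v"
proof -
  have sub: "{z \<in> X. z \<prec> u} \<subseteq> {z \<in> X. z \<prec> v}" "{z \<in> X. v \<prec> z} \<subseteq> {z \<in> X. u \<prec> z}"
    using assms by (auto simp: before_def)
  then have "card {z \<in> X. z \<prec> u} \<le> card {z \<in> X. z \<prec> v}" "card {z \<in> X. v \<prec> z} \<le> card {z \<in> X. u \<prec> z}"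
    using assms(1) by (auto intro!: card_mono)
  with assms(5) have "card {z \<in> X. z \<prec> u} = card {z \<in> X. z \<prec> v}"
    "card {z \<in> X. v \<prec> z} = card {z \<in> X. u \<prec> z}"
    by (auto simp: rank_def)
  then have "{z \<in> X. z \<prec> u} = {z \<in> X. z \<prec> v}" "{z \<in> X. v \<prec> z} = {z \<in> X. u \<prec> z}"
    using card_subset_eq[OF _ sub(1)] card_subset_eq[OF _ sub(2)] assms(1) by auto
  then have "twins X (\<prec>) u v"
    unfolding twins_def by blast
  with assms show ?thesis
    using twin_free by blast
qed

lemma inj_on_rank:
  assumes "finite X"
  shows "inj_on rank Q"
proof (rule inj_onI)
  fix u v assume "u \<in> Q" "v \<in> Q" "rank u = rank v"
  then show "u = v"
    using before_total[of u v] before_rank_eq_imp_eq[OF assms] Q_subset by metis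
qed

lemma ex_unit_OC_rep:
  assumes "finite X"
  shows "unit_OC_interval_order X (\<prec>)"
proof -
  let ?ge = "cell_prec X (\<prec>)"
  have "\<exists>l :: 'a \<Rightarrow> real. \<forall>u\<in>Q. \<forall>v\<in>Q. rank u < rank v \<longrightarrow>
      l u < l v \<and> (?ge u v \<longleftrightarrow> l u + 1 \<le> l v) \<and> (u \<prec> v \<longleftrightarrow> l u + 1 < l v)"
  proof (rule greedy_placement)
    show "finite Q"
      using assms by (simp add: non_inner_def)
    show "inj_on rank Q"
      using assms by (rule inj_on_rank)
    show "?ge u v" if "u \<prec> v" for u v
      using that by (auto simp: cell_prec_def cell_def)
    show "u \<prec> w" if "u \<in> Q" "v \<in> Q" "w \<in> Q" "rank u < rank v" "rank v < rank w" "?ge u v" for u v w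
      using cell_prec_imp_prec_later[OF that(1-3) rank_less_imp_before[OF assms that(2,3,5)]] that
      by auto
    show "u \<prec> w" if "u \<in> Q" "v \<in> Q" "w \<in> Q" "rank u < rank v" "rank v < rank w" "?ge v w" for u v w
      using cell_prec_imp_prec_earlier[OF that(1-3) rank_less_imp_before[OF assms that(1,2,4)]] that
      by auto
  qed
  then obtain l :: "'a \<Rightarrow> real" where l: "\<And>u v. u \<in> Q \<Longrightarrow> v \<in> Q \<Longrightarrow> rank u < rank v \<Longrightarrow>
      l u < l v \<and> (?ge u v \<longleftrightarrow> l u + 1 \<le> l v) \<and> (u \<prec> v \<longleftrightarrow> l u + 1 < l v)"
    by blast
  \<comment> \<open>The non-inner point whose cell contains \<open>s\<close>; by
    \<open>inner_unique\<close> there is only one choice of \<open>y\<close>.\<close>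
  define \<pi> where "\<pi> s = (if s \<in> Q then s else (SOME y. inn s y))" for s
  have \<pi>: "\<pi> s \<in> Q \<and> s \<in> cell X (\<prec>) (\<pi> s)" if "s \<in> X" for s
  proof (cases "s \<in> Q")
    case False
    then have "\<exists>y. inn s y"
      using that by (auto simp: non_inner_def)
    then have "inn s (\<pi> s)"
      unfolding \<pi>_def using False by (simp add: someI_ex)
    then show ?thesis
      using inner_imp_non_inner by (auto simp: cell_def)
  qed (simp add: \<pi>_def cell_def)
  define L where "L s = l (\<pi> s)" for s
  have "s \<prec> t \<longleftrightarrow> L s + 1 < L t \<or> L s + 1 = L t \<and> \<not> (s \<in> Q \<and> t \<in> Q)" if st: "s \<in> X" "t \<in> X" for s t
  proof (cases "rank (\<pi> s) < rank (\<pi> t)")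
    case True
    note l' = l[OF conjunct1[OF \<pi>[OF st(1)]] conjunct1[OF \<pi>[OF st(2)]] True]
    show ?thesis
    proof (cases "s \<in> Q \<and> t \<in> Q")
      case True
      then have "\<pi> s = s" "\<pi> t = t" by (auto simp: \<pi>_def)
      with l' True show ?thesis by (auto simp: L_def)
    next
      case False
      then have "s \<prec> t \<longleftrightarrow> ?ge (\<pi> s) (\<pi> t)"
        using \<pi> st by (intro cell_prec_iff) auto
      with l' False show ?thesis by (auto simp: L_def)
    qed
  next
    case False
    \<comment> \<open>The cells coincide or stand in reverse order, so both sides of the equivalence
      are false.\<close>
    have "before X (\<prec>) (\<pi> t) (\<pi> s) \<and> l (\<pi> t) \<le> l (\<pi> s)"
    proof (cases "rank (\<pi> t) < rank (\<pi> s)")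
      case True
      then show ?thesis
        using l[of "\<pi> t" "\<pi> s"] rank_less_imp_before[OF assms, of "\<pi> t" "\<pi> s"]
          \<pi>[OF st(1)] \<pi>[OF st(2)] by auto
    next
      case eq: False
      with False have "\<pi> s = \<pi> t"
        using inj_onD[OF inj_on_rank[OF assms], of "\<pi> s" "\<pi> t"] \<pi>[OF st(1)] \<pi>[OF st(2)] by auto
      then show ?thesis by (simp add: before_def)
    qed
    moreover from this have "\<not> ?ge (\<pi> s) (\<pi> t)"
      using before_not_cell_prec \<pi> st by blast
    then have "\<not> s \<prec> t"
      using \<pi> st by (auto simp: cell_prec_def)
    ultimately show ?thesis by (auto simp: L_def)
  qed
  then have "OC_rep X (\<prec>) L (\<lambda>s. L s + 1) (\<lambda>s. s \<in> Q)"
    by (simp add: OC_rep_iff oc_valid_def)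
  then show ?thesis
    unfolding unit_OC_interval_order_def by (intro exI conjI) auto
qed

end

section \<open>From excluded induced subposets to \<open>forbidden_free\<close>\<close>

lemma all_less_5: "(\<forall>i<5::nat. P i) \<longleftrightarrow> P 0 \<and> P 1 \<and> P 2 \<and> P 3 \<and> P 4"
proof -
  have "i < 5 \<longleftrightarrow> i = 0 \<or> i = 1 \<or> i = 2 \<or> i = 3 \<or> i = 4" for i :: nat by linarith
  then show ?thesis by (simp add: all_conj_distrib)
qed

lemma all_less_6: "(\<forall>i<6::nat. P i) \<longleftrightarrow> P 0 \<and> P 1 \<and> P 2 \<and> P 3 \<and> P 4 \<and> P 5"
proof -
  have "i < 6 \<longleftrightarrow> i = 0 \<or> i = 1 \<or> i = 2 \<or> i = 3 \<or> i = 4 \<or> i = 5" for i :: nat by linarith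
  then show ?thesis by (simp add: all_conj_distrib)
qed

lemma contains_induced_listI:
  assumes "set xs \<subseteq> X" "distinct xs" "length xs = n"
    and "\<forall>i<n. \<forall>j<n. prec (xs ! i) (xs ! j) \<longleftrightarrow> Q i j"
  shows "contains_induced X prec n Q"
  unfolding contains_induced_def
proof (intro exI conjI)
  show "inj_on ((!) xs) {..<n}"
    using assms by (intro inj_on_nth) auto
  show "(!) xs ` {..<n} \<subseteq> X"
    using assms(1,3) by auto
  show "\<forall>i<n. \<forall>j<n. prec (xs ! i) (xs ! j) \<longleftrightarrow> Q i j"
    by (rule assms(4))
qed

text \<open>If an axiom excluding a poset fails, linear inequalities between the interval endpoints
  settle all other relations and exhibit an induced copy.\<close>

lemma forbidden_free_if_no_induced:
  assumes po: "strict_poset X prec" and tf: "twin_free X prec" and io: "interval_order X prec"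
    and no: "\<not> contains_induced X prec 5 pat_4_1" "\<not> contains_induced X prec 5 pat_3_1_1"
      "\<not> contains_induced X prec 6 pat_Z" "\<not> contains_induced X prec 5 pat_D"
      "\<not> contains_induced X prec 5 pat_Y" "\<not> contains_induced X prec 5 pat_Y_dual"
  shows "forbidden_free X prec"
proof -
  obtain L R :: "'a \<Rightarrow> real" where LR: "\<And>x. x \<in> X \<Longrightarrow> L x \<le> R x"
      "\<And>x y. x \<in> X \<Longrightarrow> y \<in> X \<Longrightarrow> prec x y \<longleftrightarrow> R x < L y"
    using io unfolding interval_order_def by blast
  note simps = LR(2) pat_4_1_def pat_3_1_1_def pat_Z_def pat_D_def pat_Y_def pat_Y_dual_def
  \<comment> \<open>Proved first because the cases of \<open>D\<close>, \<open>Y\<close> and its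
    dual use it: comparable \<open>b\<close> and \<open>c\<close> would yield a chain of four
    incomparable to \<open>x\<close>.\<close>
  have no_4_1: "prec a x \<or> prec x d"
    if X: "a \<in> X" "b \<in> X" "c \<in> X" "d \<in> X" "x \<in> X" and "prec a b" "prec b c" "prec c d"
    for a b c d x
  proof (rule ccontr)
    assume neg: "\<not> ?thesis"
    note lr = X[THEN LR(1)] that(6-8)[unfolded LR(2)[OF X(1,2)] LR(2)[OF X(2,3)] LR(2)[OF X(3,4)]]
      neg[unfolded LR(2)[OF X(1,5)] LR(2)[OF X(5,4)]]
    have "contains_induced X prec 5 pat_4_1"
    proof (rule contains_induced_listI[of "[a, b, c, d, x]"])
      show "distinct [a, b, c, d, x]" using lr by auto
      show "\<forall>i<5. \<forall>j<5. prec ([a, b, c, d, x] ! i) ([a, b, c, d, x] ! j) \<longleftrightarrow> pat_4_1 i j"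
        using lr X by (simp add: all_less_5 simps)
    qed (use X in auto)
    with no(1) show False ..
  qed
  show ?thesis
  proof
    show "\<not> prec x x" if "x \<in> X" for x
      using po that by (simp add: strict_poset_def)
    show "prec x w \<or> prec z y" if "x \<in> X" "y \<in> X" "z \<in> X" "w \<in> X" "prec x y" "prec z w" for x y z w
      using that by (auto simp: LR(2))
    show "x = y" if "x \<in> X" "y \<in> X" "twins X prec x y" for x y
      using tf that by (simp add: twin_free_def)
    show "prec a x \<or> prec x d"
      if "a \<in> X" "b \<in> X" "c \<in> X" "d \<in> X" "x \<in> X" and "prec a b" "prec b c" "prec c d"
      for a b c d x
      using no_4_1 that by blast
  next
    fix a b c x y
    assume X: "a \<in> X" "b \<in> X" "c \<in> X" "x \<in> X" "y \<in> X" and p: "prec a b" "prec b c"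
    show "prec a x \<or> prec x c \<or> prec a y \<or> prec y c \<or> x = y"
    proof (rule ccontr)
      assume neg: "\<not> ?thesis"
      note lr = X[THEN LR(1)] p[unfolded LR(2)[OF X(1,2)] LR(2)[OF X(2,3)]]
        neg[unfolded LR(2)[OF X(1,4)] LR(2)[OF X(4,3)] LR(2)[OF X(1,5)] LR(2)[OF X(5,3)]]
      have "contains_induced X prec 5 pat_3_1_1"
      proof (rule contains_induced_listI[of "[a, b, c, x, y]"])
        show "distinct [a, b, c, x, y]" using lr by auto
        show "\<forall>i<5. \<forall>j<5. prec ([a, b, c, x, y] ! i) ([a, b, c, x, y] ! j) \<longleftrightarrow> pat_3_1_1 i j"
          using lr X by (simp add: all_less_5 simps)
      qed (use X in auto)
      with no(2) show False ..
    qed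
  next
    fix a b c d x y
    assume X: "a \<in> X" "b \<in> X" "c \<in> X" "d \<in> X" "x \<in> X" "y \<in> X"
      and p: "prec a b" "prec b c" "prec c d" "prec x d" "prec a y"
    show "prec a x \<or> prec x c \<or> prec b y \<or> prec y d"
    proof (rule ccontr)
      assume neg: "\<not> ?thesis"
      note lr = X[THEN LR(1)]
        p[unfolded LR(2)[OF X(1,2)] LR(2)[OF X(2,3)] LR(2)[OF X(3,4)] LR(2)[OF X(5,4)] LR(2)[OF X(1,6)]]
        neg[unfolded LR(2)[OF X(1,5)] LR(2)[OF X(5,3)] LR(2)[OF X(2,6)] LR(2)[OF X(6,4)]]
      have "contains_induced X prec 6 pat_Z"
      proof (rule contains_induced_listI[of "[a, b, c, d, x, y]"])
        show "distinct [a, b, c, d, x, y]" using lr by auto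
        show "\<forall>i<6. \<forall>j<6. prec ([a, b, c, d, x, y] ! i) ([a, b, c, d, x, y] ! j) \<longleftrightarrow> pat_Z i j"
          using lr X by (simp add: all_less_6 simps)
      qed (use X in auto)
      with no(3) show False ..
    qed
  next
    fix a b c d x
    assume X: "a \<in> X" "b \<in> X" "c \<in> X" "d \<in> X" "x \<in> X"
      and p: "prec a b" "prec b d" "prec a c" "prec c d"
    show "prec a x \<or> prec x d \<or> b = c"
    proof (rule ccontr)
      assume neg: "\<not> ?thesis"
      then have "\<not> prec b c" "\<not> prec c b"
        using no_4_1[of a b c d x] no_4_1[of a c b d x] X p by blast+
      note lr = X[THEN LR(1)] this[unfolded LR(2)[OF X(2,3)] LR(2)[OF X(3,2)]]
        p[unfolded LR(2)[OF X(1,2)] LR(2)[OF X(2,4)] LR(2)[OF X(1,3)] LR(2)[OF X(3,4)]]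
        neg[unfolded LR(2)[OF X(1,5)] LR(2)[OF X(5,4)]]
      have "contains_induced X prec 5 pat_D"
      proof (rule contains_induced_listI[of "[a, b, c, d, x]"])
        show "distinct [a, b, c, d, x]" using lr by auto
        show "\<forall>i<5. \<forall>j<5. prec ([a, b, c, d, x] ! i) ([a, b, c, d, x] ! j) \<longleftrightarrow> pat_D i j"
          using lr X by (simp add: all_less_5 simps)
      qed (use X in auto)
      with no(4) show False ..
    qed
  next
    fix a b c d x
    assume X: "a \<in> X" "b \<in> X" "c \<in> X" "d \<in> X" "x \<in> X"
      and p: "prec a d" "prec d b" "prec d c"
    show "prec a x \<or> prec x b \<or> prec x c \<or> b = c"
    proof (rule ccontr)
      assume neg: "\<not> ?thesis"
      then have "\<not> prec b c" "\<not> prec c b"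
        using no_4_1[of a d b c x] no_4_1[of a d c b x] X p by blast+
      note lr = X[THEN LR(1)] this[unfolded LR(2)[OF X(2,3)] LR(2)[OF X(3,2)]]
        p[unfolded LR(2)[OF X(1,4)] LR(2)[OF X(4,2)] LR(2)[OF X(4,3)]]
        neg[unfolded LR(2)[OF X(1,5)] LR(2)[OF X(5,2)] LR(2)[OF X(5,3)]]
      have "contains_induced X prec 5 pat_Y"
      proof (rule contains_induced_listI[of "[a, b, c, d, x]"])
        show "distinct [a, b, c, d, x]" using lr by auto
        show "\<forall>i<5. \<forall>j<5. prec ([a, b, c, d, x] ! i) ([a, b, c, d, x] ! j) \<longleftrightarrow> pat_Y i j"
          using lr X by (simp add: all_less_5 simps)
      qed (use X in auto)
      with no(5) show False ..
    qed
  next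
    fix a b c d x
    assume X: "a \<in> X" "b \<in> X" "c \<in> X" "d \<in> X" "x \<in> X"
      and p: "prec d a" "prec b d" "prec c d"
    show "prec x a \<or> prec b x \<or> prec c x \<or> b = c"
    proof (rule ccontr)
      assume neg: "\<not> ?thesis"
      then have "\<not> prec b c" "\<not> prec c b"
        using no_4_1[of b c d a x] no_4_1[of c b d a x] X p by blast+
      note lr = X[THEN LR(1)] this[unfolded LR(2)[OF X(2,3)] LR(2)[OF X(3,2)]]
        p[unfolded LR(2)[OF X(4,1)] LR(2)[OF X(2,4)] LR(2)[OF X(3,4)]]
        neg[unfolded LR(2)[OF X(5,1)] LR(2)[OF X(2,5)] LR(2)[OF X(3,5)]]
      have "contains_induced X prec 5 pat_Y_dual"
      proof (rule contains_induced_listI[of "[a, b, c, d, x]"])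
        show "distinct [a, b, c, d, x]" using lr by auto
        show "\<forall>i<5. \<forall>j<5. prec ([a, b, c, d, x] ! i) ([a, b, c, d, x] ! j) \<longleftrightarrow> pat_Y_dual i j"
          using lr X by (simp add: all_less_5 simps)
      qed (use X in auto)
      with no(6) show False ..
    qed
  qed
qed

theorem theorem12:
  fixes X :: "'a set" and prec :: "'a \<Rightarrow> 'a \<Rightarrow> bool"
  assumes "strict_poset X prec" and "finite X" and "twin_free X prec"
    and "interval_order X prec"
  shows "(unit_OC_interval_order X prec \<longleftrightarrow> strict_OC_interval_order X prec) \<and>
         (strict_OC_interval_order X prec \<longleftrightarrow>
            \<not> contains_induced X prec 5 pat_4_1 \<and>
            \<not> contains_induced X prec 5 pat_3_1_1 \<and>
            \<not> contains_induced X prec 6 pat_Z \<and>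
            \<not> contains_induced X prec 5 pat_D \<and>
            \<not> contains_induced X prec 5 pat_Y \<and>
            \<not> contains_induced X prec 5 pat_Y_dual)"
    (is "(?unit \<longleftrightarrow> ?strict) \<and> (_ \<longleftrightarrow> ?free)")
proof -
  have "?unit \<Longrightarrow> ?strict"
    by (rule unit_imp_strict_OC_interval_order)
  moreover have "?free" if so: ?strict
  proof -
    obtain L R C where rep: "OC_rep X prec L R C" and strict:
        "\<forall>u\<in>X. \<forall>v\<in>X. \<not> strictly_contained (L u) (R u) (C u) (L v) (R v) (C v)"
      using so unfolding strict_OC_interval_order_def by blast
    interpret strict_OC_rep X prec L R C
      by (rule strict_OC_rep.intro[OF rep _ assms(3)]) (use strict in blast)
    show ?thesis
      by (intro conjI no_4_1 no_3_1_1 no_Z no_D no_Y no_Y_dual)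
  qed
  moreover have "?unit" if ?free
  proof (rule forbidden_free.ex_unit_OC_rep[OF _ assms(2)])
    show "forbidden_free X prec"
      by (rule forbidden_free_if_no_induced[OF assms(1,3,4)]) (use that in simp_all)
  qed
  ultimately show ?thesis by argo
qed

end
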